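(* For all $F\ge0$ and $\lambda>0$, $$\mathbb M(0,F,\lambda)\ \le\ \frac{F}{\mathbb L(0,1,\lambda)}=\frac{F}{\mathbb L_b(0,\lambda)}.$$
   Context: $\mathcal D$ denotes the standard collection of dyadic intervals of $\mathbb R$. For $I\in\mathcal D$, $I_-$ and $I_+$ are its left and right halves, $\mathbf 1_I$ its indicator function, and $|E|$ denotes Lebesgue measure. For integrable $\varphi$, $\langle\varphi\rangle_I=\frac1{|I|}\int_I\varphi\,dx$. Functions are real-valued. For $J\in\mathcal D$ the (localized) dyadic square function is given by $$S_J^2\varphi(x)=\sum_{I\in\mathcal D,\ I\subseteq J}|\Delta_I\varphi|^2\,\mathbf 1_I(x),\qquad \Delta_I\varphi=\tfrac12\big(\langle\varphi\rangle_{I_+}-\langle\varphi\rangle_{I_-}\big)\big(\mathbf 1_{I_+}-\mathbf 1_{I_-}\big).$$ For $f\in\mathbb R$, $F\ge|f|$, $\lambda>0$, $$\mathbb M(f,F,\lambda)=\sup\frac1{|J|}|\{x\in J:S_J^2\varphi(x)\ge\lambda\}|,$$ the supremum being over all integrable $\varphi$ supported in $J\in\mathcal D$ with $\langle\varphi\rangle_J=f$ and $\langle|\varphi|\rangle_J=F$. For $f\in\mathbb R$, $0\le p\le1$, $\lambda>0$, $$\mathbb L(f,p,\lambda)=\inf\langle|\varphi|\rangle_J,$$ the infimum being over all integrable $\varphi$ supported in $J\in\mathcal D$ with $\langle\varphi\rangle_J=f$ and $\frac1{|J|}|\{x\in J:S_J^2\varphi(x)\ge\lambda\}|=p$. Neither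 quantity depends on the choice of $J$. Finally $\mathbb L_b(f,\lambda):=\mathbb L(f,1,\lambda)$. *)

theory Defs
  imports "HOL-Analysis.Analysis"
begin

definition dyadic_intervals :: "real set set" where
  "dyadic_intervals =
     {{of_int k * 2 powi n ..< (of_int k + 1) * 2 powi n} | (k :: int) (n :: int). True}"

definition left_half :: "real set \<Rightarrow> real set" where
  "left_half I = {Inf I ..< (Inf I + Sup I) / 2}"

definition right_half :: "real set \<Rightarrow> real set" where
  "right_half I = {(Inf I + Sup I) / 2 ..< Sup I}"

definition avg :: "real set \<Rightarrow> (real \<Rightarrow> real) \<Rightarrow> real" where
  "avg I \<phi> = (LINT x:I|lebesgue. \<phi> x) / measure lebesgue I"

definition dyadic_diff :: "real set \<Rightarrow> (real \<Rightarrow> real) \<Rightarrow> real \<Rightarrow> real" where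
  "dyadic_diff I \<phi> x =
     1 / 2 * (avg (right_half I) \<phi> - avg (left_half I) \<phi>)
       * (indicator (right_half I) x - indicator (left_half I) x)"

text \<open>The square function may be infinite at some points, so its square takes values in
  \<^typ>\<open>ennreal\<close>, where every family is summable.\<close>

definition square_fun_sq :: "real set \<Rightarrow> (real \<Rightarrow> real) \<Rightarrow> real \<Rightarrow> ennreal" where
  "square_fun_sq J \<phi> x =
     (\<Sum>\<^sub>\<infinity> I \<in> {I \<in> dyadic_intervals. I \<subseteq> J}.
        ennreal (\<bar>dyadic_diff I \<phi> x\<bar>\<^sup>2 * indicator I x))"

definition level_fraction :: "real set \<Rightarrow> (real \<Rightarrow> real) \<Rightarrow> real \<Rightarrow> real" where
  "level_fraction J \<phi> lam =
     measure lebesgue {x \<in> J. square_fun_sq J \<phi> x \<ge> ennreal lam} / measure lebesgue J"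

definition integrable_supported :: "real set \<Rightarrow> (real \<Rightarrow> real) \<Rightarrow> bool" where
  "integrable_supported J \<phi> \<longleftrightarrow> integrable lebesgue \<phi> \<and> (\<forall>x. x \<notin> J \<longrightarrow> \<phi> x = 0)"

text \<open>Both extremal quantities are invariant under rescaling of the base interval, so \<open>J\<close>
  ranges over all dyadic intervals instead of being a parameter. On the domains
  \<open>F \<ge> \<bar>f\<bar>\<close>, \<open>lam > 0\<close> and \<open>0 \<le> p \<le> 1\<close>, \<open>lam > 0\<close> respectively, the sets below are nonempty
  and bounded, so the real-valued supremum and infimum are genuine.\<close>

definition M_bell :: "real \<Rightarrow> real \<Rightarrow> real \<Rightarrow> real" where
  "M_bell f F lam =
     Sup {level_fraction J \<phi> lam | J \<phi>. J \<in> dyadic_intervals \<and> integrable_supported J \<phi> \<and>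
            avg J \<phi> = f \<and> avg J (\<lambda>x. \<bar>\<phi> x\<bar>) = F}"

definition L_bell :: "real \<Rightarrow> real \<Rightarrow> real \<Rightarrow> real" where
  "L_bell f p lam =
     Inf {avg J (\<lambda>x. \<bar>\<phi> x\<bar>) | J \<phi>. J \<in> dyadic_intervals \<and> integrable_supported J \<phi> \<and>
            avg J \<phi> = f \<and> level_fraction J \<phi> lam = p}"

definition Lb_bell :: "real \<Rightarrow> real \<Rightarrow> real" where
  "Lb_bell f lam = L_bell f 1 lam"

end

theory Submission
  imports Defs
begin

text \<open>A function on \<open>J\<close> is a martingale with steps \<open>f \<mapsto> f \<plusminus> a\<close> along which the square function
  \<open>s\<close> grows by \<open>a\<^sup>2\<close>. Let \<open>B(f, \<mu>)\<close> be the least mean of \<open>\<bar>\<phi>\<bar>\<close> over finite martingales that start at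
  \<open>f\<close> and whose square function reaches \<open>\<mu>\<close> everywhere. Concatenation gives
  \<open>B(f, \<mu>) \<le> (B(f + a, \<mu> - a\<^sup>2) + B(f - a, \<mu> - a\<^sup>2)) / 2\<close>, and moving \<open>f\<close> to \<open>0\<close> first, with no increase of
  \<open>\<bar>f\<bar>\<close> in the mean, gives \<open>B(f, \<mu>) \<le> \<bar>f\<bar> + B(0, \<lambda>)\<close> for \<open>\<mu> \<le> \<lambda>\<close>. Hence
  \<open>U(f, s) = B(f, \<lambda> - s) - B(0, \<lambda>)\<close> has the submartingale property, vanishes at \<open>(0, 0)\<close> and is at
  most \<open>\<bar>f\<bar>\<close>, and at most \<open>\<bar>f\<bar> - B(0, \<lambda>)\<close> once \<open>s \<ge> \<lambda>\<close>. Following it along an arbitrary \<open>\<phi>\<close> bounds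
  \<open>B(0, \<lambda>)\<close> times the level fraction by the mean of \<open>\<bar>\<phi>\<bar>\<close>, and \<open>L(0, 1, \<lambda>) \<le> B(0, \<lambda>)\<close> since finite
  martingales are realized by step functions. The same principle with an explicit \<open>U\<close> gives a
  weak-type bound, so \<open>L(0, 1, \<lambda>) > 0\<close> and the quotient is not the junk value \<open>F / 0 = 0\<close>.\<close>

section \<open>Dyadic intervals and the square function\<close>

lemma dyadic_intervalE:
  assumes "J \<in> dyadic_intervals"
  obtains l h :: real where "h > 0" "J = {l..<l+h}"
    "left_half J = {l..<l+h/2}" "right_half J = {l+h/2..<l+h}"
proof -
  obtain k n :: int where J: "J = {of_int k * 2 powi n ..< (of_int k + 1) * 2 powi n}"
    using assms by (auto simp: dyadic_intervals_def)
  define l h :: real where "l = of_int k * 2 powi n" and "h = 2 powi n"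
  have h: "h > 0" by (simp add: h_def)
  have J': "J = {l..<l+h}" by (simp add: J l_def h_def algebra_simps)
  have "Inf J = l" "Sup J = l + h" using h by (simp_all add: J')
  then show thesis
    by (intro that[of h l] h J') (auto simp: left_half_def right_half_def field_simps)
qed

lemma half_dyadic:
  assumes "J \<in> dyadic_intervals"
  shows "left_half J \<in> dyadic_intervals" "right_half J \<in> dyadic_intervals"
proof -
  obtain k n :: int where J: "J = {of_int k * 2 powi n ..< (of_int k + 1) * 2 powi n}"
    using assms by (auto simp: dyadic_intervals_def)
  have p: "(2::real) powi n = 2 * 2 powi (n - 1)"
    by (simp add: power_int_diff)
  define q :: real where "q = 2 powi (n - 1)"
  have q: "q > 0" by (simp add: q_def)
  have J': "J = {2 * of_int k * q ..< (2 * of_int k + 2) * q}"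
    by (simp add: J p q_def[symmetric] algebra_simps)
  have less: "2 * of_int k * q < (2 * of_int k + 2) * q" using q by simp
  have *: "Inf J = 2 * of_int k * q" "Sup J = (2 * of_int k + 2) * q"
    using less by (simp_all add: J')
  have mid: "(Inf J + Sup J) / 2 = (2 * of_int k + 1) * q"
    unfolding * by (simp add: field_simps)
  have "left_half J = {of_int (2 * k) * 2 powi (n - 1) ..< (of_int (2 * k) + 1) * 2 powi (n - 1)}"
    unfolding left_half_def mid unfolding * q_def[symmetric] by simp
  then show "left_half J \<in> dyadic_intervals" unfolding dyadic_intervals_def by blast
  have "right_half J = {of_int (2 * k + 1) * 2 powi (n - 1) ..< (of_int (2 * k + 1) + 1) * 2 powi (n - 1)}"
    unfolding right_half_def mid unfolding * q_def[symmetric] by (simp add: add.commute)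
  then show "right_half J \<in> dyadic_intervals" unfolding dyadic_intervals_def by blast
qed

text \<open>In units of the length of \<open>I\<close>, the midpoint of a strictly longer
  \<open>J\<close> is an integer, and so are the consecutive endpoints of \<open>I\<close>; hence
  the midpoint cannot fall strictly inside \<open>I\<close>.\<close>

lemma dyadic_subset_cases:
  assumes "I \<in> dyadic_intervals" "J \<in> dyadic_intervals" "I \<subseteq> J"
  shows "I = J \<or> I \<subseteq> left_half J \<or> I \<subseteq> right_half J"
proof -
  obtain i m :: int where I: "I = {of_int i * 2 powi m ..< (of_int i + 1) * 2 powi m}"
    using assms by (auto simp: dyadic_intervals_def)
  obtain j n :: int where J: "J = {of_int j * 2 powi n ..< (of_int j + 1) * 2 powi n}"
    using assms by (auto simp: dyadic_intervals_def)
  define p :: real where "p = 2 powi m"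
  define q :: real where "q = 2 powi n"
  have p: "p > 0" and q: "q > 0" by (simp_all add: p_def q_def)
  have I': "I = {of_int i * p ..< (of_int i + 1) * p}" by (simp add: I p_def)
  have J': "J = {of_int j * q ..< (of_int j + 1) * q}" by (simp add: J q_def)
  have "of_int i * p < (of_int i + 1) * p" using p by simp
  then have le: "of_int j * q \<le> of_int i * p" "(of_int i + 1) * p \<le> (of_int j + 1) * q"
    using assms(3) unfolding I' J' by (auto dest!: atLeastLessThan_subset_iff)
  then have "p \<le> q" by (simp add: algebra_simps)
  then have "m \<le> n"
    using power_int_strict_increasing[of n m "2 :: real"] by (force simp: p_def q_def)
  show ?thesis
  proof (cases "m = n")
    case True
    then have "p = q" by (simp add: p_def q_def)
    then have "of_int i * p = of_int j * q" using le by (simp add: algebra_simps)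
    then have "I = J" unfolding I' J' using \<open>p = q\<close> q by auto
    then show ?thesis ..
  next
    case False
    define d where "d = nat (n - 1 - m)"
    have qd: "q = 2 * (2 ^ d * p)"
    proof -
      have "n = 1 + int d + m" using False \<open>m \<le> n\<close> by (simp add: d_def)
      then show ?thesis by (simp add: q_def p_def power_int_add)
    qed
    have "of_int j * q < (of_int j + 1) * q" using q by simp
    then have IS: "Inf J = of_int j * q" "Sup J = (of_int j + 1) * q"
      unfolding J' by simp_all
    have mid: "(Inf J + Sup J) / 2 = of_int ((2 * j + 1) * 2 ^ d) * p"
      unfolding IS by (simp add: qd algebra_simps)
    consider "i + 1 \<le> (2 * j + 1) * 2 ^ d" | "(2 * j + 1) * 2 ^ d \<le> i" by linarith
    then show ?thesis
    proof cases
      case 1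
      then have "of_int (i + 1) * p \<le> of_int ((2 * j + 1) * 2 ^ d) * p"
        using p by (intro mult_right_mono of_int_le_iff[THEN iffD2]) auto
      then have "I \<subseteq> left_half J"
        unfolding left_half_def mid using le by (auto simp: I' IS)
      then show ?thesis by blast
    next
      case 2
      then have "of_int ((2 * j + 1) * 2 ^ d) * p \<le> of_int i * p"
        using p by (intro mult_right_mono of_int_le_iff[THEN iffD2]) auto
      then have "I \<subseteq> right_half J"
        unfolding right_half_def mid using le by (auto simp: I' IS)
      then show ?thesis by blast
    qed
  qed
qed

lemma half_partition:
  assumes "J \<in> dyadic_intervals"
  shows "left_half J \<union> right_half J = J" "left_half J \<inter> right_half J = {}"
  using assms by (elim dyadic_intervalE; auto simp: ivl_disj_un)+

lemma dyadic_nonempty: "J \<in> dyadic_intervals \<Longrightarrow> J \<noteq> {}"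
  by (elim dyadic_intervalE) auto

lemma dyadic_lmeasurable: "J \<in> dyadic_intervals \<Longrightarrow> J \<in> lmeasurable"
  by (elim dyadic_intervalE) (simp add: fmeasurable_def)

lemma measure_dyadic_pos: "J \<in> dyadic_intervals \<Longrightarrow> measure lebesgue J > 0"
  by (elim dyadic_intervalE) auto

lemma measure_half:
  assumes "J \<in> dyadic_intervals"
  shows "measure lebesgue (left_half J) = measure lebesgue J / 2"
    "measure lebesgue (right_half J) = measure lebesgue J / 2"
  using assms by (elim dyadic_intervalE; simp)+

text \<open>The signed martingale increment: passing to a half changes the mean by plus or minus
  this number, and its square is what \<open>J\<close> contributes to the square function at every
  point of \<open>J\<close>.\<close>

definition half_diff :: "real set \<Rightarrow> (real \<Rightarrow> real) \<Rightarrow> real" where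
  "half_diff J \<phi> = (avg (right_half J) \<phi> - avg (left_half J) \<phi>) / 2"

lemma set_integral_halves:
  fixes \<phi> :: "real \<Rightarrow> real"
  assumes "J \<in> dyadic_intervals" "integrable lebesgue \<phi>"
  shows "(LINT x:J|lebesgue. \<phi> x)
    = (LINT x:left_half J|lebesgue. \<phi> x) + (LINT x:right_half J|lebesgue. \<phi> x)"
proof -
  have "set_integrable lebesgue I \<phi>" if "I \<in> dyadic_intervals" for I
    unfolding set_integrable_def
    by (intro integrable_mult_indicator fmeasurableD dyadic_lmeasurable that assms(2))
  then show ?thesis
    using set_integral_Un[of "left_half J" "right_half J" lebesgue \<phi>] half_partition[OF assms(1)]
      half_dyadic[OF assms(1)] by simp
qed

lemma avg_halves:
  assumes "J \<in> dyadic_intervals" "integrable lebesgue \<phi>"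
  shows "avg J \<phi> = (avg (left_half J) \<phi> + avg (right_half J) \<phi>) / 2"
  unfolding avg_def set_integral_halves[OF assms] measure_half[OF assms(1)]
  by (simp add: add_divide_distrib)

lemma avg_half_eq:
  assumes "J \<in> dyadic_intervals" "integrable lebesgue \<phi>"
  shows "avg (left_half J) \<phi> = avg J \<phi> - half_diff J \<phi>"
    "avg (right_half J) \<phi> = avg J \<phi> + half_diff J \<phi>"
  by (simp_all add: avg_halves[OF assms] half_diff_def field_simps)

lemma dyadic_diff_sq:
  assumes "J \<in> dyadic_intervals" "x \<in> J"
  shows "(dyadic_diff J \<phi> x)\<^sup>2 = (half_diff J \<phi>)\<^sup>2"
proof -
  have "x \<in> left_half J \<and> x \<notin> right_half J \<or> x \<in> right_half J \<and> x \<notin> left_half J"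
    using half_partition[OF assms(1)] assms(2) by blast
  then show ?thesis by (auto simp: dyadic_diff_def half_diff_def power2_eq_square)
qed

section \<open>Truncations of the square function\<close>

text \<open>The contribution of the first \<open>n\<close> generations, in the reals and by
  recursion on the first split, so that inductions can follow the martingale. It is meaningful for
  \<open>x\<close> in \<open>J\<close> only: a point outside is sent to the right at every
  split.\<close>

primrec finite_square_fun :: "nat \<Rightarrow> real set \<Rightarrow> (real \<Rightarrow> real) \<Rightarrow> real \<Rightarrow> real" where
  "finite_square_fun 0 J \<phi> x = 0"
| "finite_square_fun (Suc n) J \<phi> x = (half_diff J \<phi>)\<^sup>2 +
     (if x \<in> left_half J then finite_square_fun n (left_half J) \<phi> x
      else finite_square_fun n (right_half J) \<phi> x)"

lemma finite_square_fun_nonneg: "finite_square_fun n J \<phi> x \<ge> 0"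
  by (induction n arbitrary: J) auto

lemma finite_square_fun_mono: "n \<le> m \<Longrightarrow> finite_square_fun n J \<phi> x \<le> finite_square_fun m J \<phi> x"
proof (induction n arbitrary: J m)
  case 0
  then show ?case by (simp add: finite_square_fun_nonneg)
next
  case (Suc n)
  then obtain m' where "m = Suc m'" "n \<le> m'" by (cases m) auto
  then show ?case using Suc.IH by simp
qed

lemma finite_square_fun_measurable:
  "J \<in> dyadic_intervals \<Longrightarrow> finite_square_fun n J \<phi> \<in> borel_measurable lebesgue"
proof (induction n arbitrary: J)
  case 0
  then show ?case by simp
next
  case (Suc n)
  note [measurable] = Suc.IH[OF half_dyadic(1)[OF Suc.prems]] Suc.IH[OF half_dyadic(2)[OF Suc.prems]]
  have [measurable]: "left_half J \<in> sets lebesgue"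
    using dyadic_lmeasurable[OF half_dyadic(1)[OF Suc.prems]] by simp
  show ?case by simp
qed

text \<open>The measure condition places each interval of \<open>A\<close> in the first
  \<open>n\<close> generations below \<open>J\<close>. Only intervals containing \<open>x\<close>
  contribute, and these are \<open>J\<close> itself or lie in the half \<open>H\<close> that
  contains \<open>x\<close>.\<close>

lemma sum_dyadic_diff_le_finite_square_fun:
  assumes "J \<in> dyadic_intervals" "x \<in> J" "finite A"
    "\<And>I. I \<in> A \<Longrightarrow> I \<in> dyadic_intervals \<and> I \<subseteq> J \<and> measure lebesgue J < 2 ^ n * measure lebesgue I"
  shows "(\<Sum>I\<in>A. \<bar>dyadic_diff I \<phi> x\<bar>\<^sup>2 * indicator I x) \<le> finite_square_fun n J \<phi> x"
  using assms
proof (induction n arbitrary: J A)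
  case 0
  have "A = {}"
  proof (rule ccontr)
    assume "A \<noteq> {}"
    then obtain I where "I \<in> A" by blast
    with 0 have "measure lebesgue J < measure lebesgue I" "I \<subseteq> J" "I \<in> dyadic_intervals" by auto
    then show False
      using measure_mono_fmeasurable[of I J lebesgue] dyadic_lmeasurable 0(1) by fastforce
  qed
  then show ?case by simp
next
  case (Suc n)
  let ?t = "\<lambda>I. \<bar>dyadic_diff I \<phi> x\<bar>\<^sup>2 * indicator I x"
  define H where "H = (if x \<in> left_half J then left_half J else right_half J)"
  have H: "H \<in> dyadic_intervals" "x \<in> H" "measure lebesgue H = measure lebesgue J / 2"
    using half_dyadic[OF Suc.prems(1)] half_partition[OF Suc.prems(1)] Suc.prems(2)
      measure_half[OF Suc.prems(1)] by (auto simp: H_def)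
  define B where "B = {I \<in> A. I \<subseteq> H}"
  have "J \<notin> B"
  proof
    assume "J \<in> B"
    then have "J \<subseteq> H" by (simp add: B_def)
    then have "measure lebesgue J \<le> measure lebesgue H"
      using H(1) Suc.prems(1) dyadic_lmeasurable by (intro measure_mono_fmeasurable) auto
    then show False using H(3) measure_dyadic_pos[OF Suc.prems(1)] by simp
  qed
  have "sum ?t A = sum ?t {I \<in> A. x \<in> I}"
    using Suc.prems(3) by (intro sum.mono_neutral_right) auto
  also have "{I \<in> A. x \<in> I} \<subseteq> insert J B"
  proof
    fix I assume "I \<in> {I \<in> A. x \<in> I}"
    then have I: "I \<in> A" "x \<in> I" "I \<in> dyadic_intervals" "I \<subseteq> J" using Suc.prems(4) by auto
    then show "I \<in> insert J B"
      using dyadic_subset_cases[OF I(3) Suc.prems(1) I(4)] half_partition[OF Suc.prems(1)]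
      by (auto simp: B_def H_def)
  qed
  then have "sum ?t {I \<in> A. x \<in> I} \<le> sum ?t (insert J B)"
    using Suc.prems(3) by (intro sum_mono2) (auto simp: B_def)
  also have "\<dots> = (half_diff J \<phi>)\<^sup>2 + sum ?t B"
    using \<open>J \<notin> B\<close> Suc.prems(2,3)
    by (subst sum.insert) (simp_all add: B_def dyadic_diff_sq[OF Suc.prems(1)])
  also have "sum ?t B \<le> finite_square_fun n H \<phi> x"
  proof (rule Suc.IH[OF H(1,2)])
    show "I \<in> dyadic_intervals \<and> I \<subseteq> H \<and> measure lebesgue H < 2 ^ n * measure lebesgue I"
      if "I \<in> B" for I
      using Suc.prems(4)[of I] that H(3) by (simp add: B_def)
  qed (use Suc.prems(3) in \<open>simp add: B_def\<close>)
  finally show ?case by (simp add: H_def split: if_splits)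
qed

text \<open>The infinite sum is bounded through its finite subsums, and a finite family of intervals
  lives in finitely many generations.\<close>

lemma square_fun_sq_le:
  assumes J: "J \<in> dyadic_intervals" "x \<in> J" and le: "\<And>n. finite_square_fun n J \<phi> x \<le> b"
  shows "square_fun_sq J \<phi> x \<le> ennreal b"
  unfolding square_fun_sq_def
proof (rule infsum_le_finite_sums)
  fix A assume A: "finite A" "A \<subseteq> {I \<in> dyadic_intervals. I \<subseteq> J}"
  have "\<forall>I\<in>A. \<forall>\<^sub>F n in sequentially. measure lebesgue J < 2 ^ n * measure lebesgue I"
  proof
    fix I assume "I \<in> A"
    then have pos: "measure lebesgue I > 0" using A(2) measure_dyadic_pos by auto
    obtain N where N: "measure lebesgue J / measure lebesgue I < 2 ^ N"
      using real_arch_pow[of 2] by auto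
    show "\<forall>\<^sub>F n in sequentially. measure lebesgue J < 2 ^ n * measure lebesgue I"
    proof (rule eventually_sequentiallyI)
      fix n assume "N \<le> n"
      then have "(2::real) ^ N \<le> 2 ^ n" by (simp add: power_increasing)
      with N have "measure lebesgue J / measure lebesgue I < 2 ^ n" by linarith
      then show "measure lebesgue J < 2 ^ n * measure lebesgue I"
        using pos by (simp add: field_simps)
    qed
  qed
  then have "\<forall>\<^sub>F n in sequentially. \<forall>I\<in>A. measure lebesgue J < 2 ^ n * measure lebesgue I"
    using A(1) by (simp add: eventually_ball_finite_distrib)
  then obtain n where "\<forall>I\<in>A. measure lebesgue J < 2 ^ n * measure lebesgue I"
    by (auto simp: eventually_sequentially)
  then have "(\<Sum>I\<in>A. \<bar>dyadic_diff I \<phi> x\<bar>\<^sup>2 * indicator I x) \<le> finite_square_fun n J \<phi> x"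
    using A by (intro sum_dyadic_diff_le_finite_square_fun J) auto
  also note le[of n]
  finally show "(\<Sum>I\<in>A. ennreal (\<bar>dyadic_diff I \<phi> x\<bar>\<^sup>2 * indicator I x)) \<le> ennreal b"
    by (simp add: ennreal_leI)
qed (simp add: nonneg_summable_on_complete)

text \<open>The interval \<open>J\<close> and the intervals inside \<open>H\<close> are distinct
  members of the family summed over for \<open>J\<close>.\<close>

lemma square_fun_sq_ge:
  assumes J: "J \<in> dyadic_intervals" "x \<in> J" and H: "H = left_half J \<or> H = right_half J"
  shows "ennreal ((half_diff J \<phi>)\<^sup>2) + square_fun_sq H \<phi> x \<le> square_fun_sq J \<phi> x"
proof -
  let ?t = "\<lambda>I. ennreal (\<bar>dyadic_diff I \<phi> x\<bar>\<^sup>2 * indicator I x)"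
  let ?D = "\<lambda>J. {I \<in> dyadic_intervals. I \<subseteq> J}"
  have "H \<subseteq> J" using H half_partition[OF J(1)] by auto
  have "\<not> J \<subseteq> H"
    using H half_partition[OF J(1)] half_dyadic[OF J(1)] dyadic_nonempty by blast
  have "ennreal ((half_diff J \<phi>)\<^sup>2) + square_fun_sq H \<phi> x = infsum ?t (insert J (?D H))"
    unfolding square_fun_sq_def using \<open>\<not> J \<subseteq> H\<close> J(2)
    by (subst infsum_insert)
      (simp_all add: nonneg_summable_on_complete dyadic_diff_sq[OF J])
  also have "\<dots> \<le> square_fun_sq J \<phi> x"
    unfolding square_fun_sq_def using \<open>H \<subseteq> J\<close> J(1)
    by (intro infsum_mono_neutral) (auto simp: nonneg_summable_on_complete)
  finally show ?thesis .
qed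

lemma avg_cong: "I \<in> dyadic_intervals \<Longrightarrow> (\<And>x. x \<in> I \<Longrightarrow> \<phi> x = \<psi> x) \<Longrightarrow> avg I \<phi> = avg I \<psi>"
  using dyadic_lmeasurable[of I] by (auto simp: avg_def intro!: arg_cong2[where f = "(/)"] set_lebesgue_integral_cong)

text \<open>Allows functions constructed separately on the two halves to be glued without changing
  their square functions there.\<close>

lemma square_fun_sq_cong:
  assumes J: "J \<in> dyadic_intervals" and eq: "\<And>x. x \<in> J \<Longrightarrow> \<phi> x = \<psi> x"
  shows "square_fun_sq J \<phi> x = square_fun_sq J \<psi> x"
  unfolding square_fun_sq_def
proof (rule infsum_cong)
  fix I assume "I \<in> {I \<in> dyadic_intervals. I \<subseteq> J}"
  then have I: "I \<in> dyadic_intervals" "\<And>x. x \<in> I \<Longrightarrow> \<phi> x = \<psi> x" using eq by auto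
  then have "avg (left_half I) \<phi> = avg (left_half I) \<psi>" "avg (right_half I) \<phi> = avg (right_half I) \<psi>"
    using half_partition[OF I(1)] by (auto intro!: avg_cong half_dyadic)
  then show "ennreal (\<bar>dyadic_diff I \<phi> x\<bar>\<^sup>2 * indicator I x) = ennreal (\<bar>dyadic_diff I \<psi> x\<bar>\<^sup>2 * indicator I x)"
    by (simp add: dyadic_diff_def)
qed

section \<open>Bellman induction\<close>

text \<open>Induction over generations, with \<open>s\<close> the square function accumulated so
  far. A split applies \<open>mid\<close> with \<open>a = half_diff J \<phi>\<close>; at the last
  generation \<open>maj\<close> applies, and the modulus of a mean is at most the mean of the
  modulus. Without division by the length of \<open>J\<close>, the contributions of the halves
  simply add.\<close>

lemma bellman_finite_levels:
  fixes U :: "real \<Rightarrow> real \<Rightarrow> real"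
  assumes mid: "\<And>x a s. s \<ge> 0 \<Longrightarrow> U x s \<le> (U (x + a) (s + a\<^sup>2) + U (x - a) (s + a\<^sup>2)) / 2"
    and maj: "\<And>x s. s \<ge> 0 \<Longrightarrow> U x s \<le> C * \<bar>x\<bar> - (if s \<ge> lam then 1 else 0)"
    and "C \<ge> 0" and \<phi>: "integrable lebesgue \<phi>"
    and "J \<in> dyadic_intervals" "s \<ge> 0"
  shows "measure lebesgue J * U (avg J \<phi>) s \<le>
    C * (LINT x:J|lebesgue. \<bar>\<phi> x\<bar>) - measure lebesgue {x \<in> J. s + finite_square_fun n J \<phi> x \<ge> lam}"
  using assms(5,6)
proof (induction n arbitrary: J s)
  case 0
  let ?m = "measure lebesgue J"
  have m: "?m > 0" using 0(1) by (rule measure_dyadic_pos)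
  have int: "set_integrable lebesgue J \<phi>"
    unfolding set_integrable_def
    by (intro integrable_mult_indicator fmeasurableD dyadic_lmeasurable 0(1) \<phi>)
  have "\<bar>LINT x:J|lebesgue. \<phi> x\<bar> \<le> (LINT x:J|lebesgue. \<bar>\<phi> x\<bar>)"
    using set_integral_norm_bound[OF int] by simp
  then have "?m * \<bar>avg J \<phi>\<bar> \<le> (LINT x:J|lebesgue. \<bar>\<phi> x\<bar>)"
    using m by (simp add: avg_def abs_divide)
  then have le: "C * (?m * \<bar>avg J \<phi>\<bar>) \<le> C * (LINT x:J|lebesgue. \<bar>\<phi> x\<bar>)"
    using \<open>C \<ge> 0\<close> by (rule mult_left_mono)
  have "?m * U (avg J \<phi>) s \<le> ?m * (C * \<bar>avg J \<phi>\<bar> - (if s \<ge> lam then 1 else 0))"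
    using maj[OF 0(2)] less_imp_le[OF m] by (rule mult_left_mono)
  also have "\<dots> = C * (?m * \<bar>avg J \<phi>\<bar>) - (if s \<ge> lam then ?m else 0)"
    by (simp add: right_diff_distrib mult.left_commute)
  also have "(if s \<ge> lam then ?m else 0) = measure lebesgue {x \<in> J. s + finite_square_fun 0 J \<phi> x \<ge> lam}"
    by (cases "s \<ge> lam") simp_all
  also have "C * (?m * \<bar>avg J \<phi>\<bar>) - \<dots> \<le> C * (LINT x:J|lebesgue. \<bar>\<phi> x\<bar>) - \<dots>"
    using le by (rule diff_right_mono)
  finally show ?case .
next
  case (Suc n)
  note J = Suc.prems(1)
  let ?L = "left_half J" and ?R = "right_half J" and ?a = "half_diff J \<phi>"
  let ?s = "s + ?a\<^sup>2"
  let ?E = "\<lambda>I. {x \<in> I. ?s + finite_square_fun n I \<phi> x \<ge> lam}"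
  have E: "?E I \<in> sets lebesgue" if "I \<in> dyadic_intervals" for I
  proof -
    note [measurable] = finite_square_fun_measurable[OF that, of n \<phi>]
    have [measurable]: "I \<in> sets lebesgue" using dyadic_lmeasurable[OF that] by simp
    have "{x \<in> space lebesgue. x \<in> I \<and> ?s + finite_square_fun n I \<phi> x \<ge> lam} \<in> sets lebesgue"
      by measurable
    then show ?thesis by simp
  qed
  have "{x \<in> J. s + finite_square_fun (Suc n) J \<phi> x \<ge> lam} = ?E ?L \<union> ?E ?R"
    using half_partition[OF J] by (auto simp: add.assoc)
  then have "measure lebesgue {x \<in> J. s + finite_square_fun (Suc n) J \<phi> x \<ge> lam}
      \<le> measure lebesgue (?E ?L) + measure lebesgue (?E ?R)"
    using measure_Un_le[OF E E] half_dyadic[OF J] by simp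
  moreover have "C * (LINT x:J|lebesgue. \<bar>\<phi> x\<bar>)
      = C * (LINT x:?L|lebesgue. \<bar>\<phi> x\<bar>) + C * (LINT x:?R|lebesgue. \<bar>\<phi> x\<bar>)"
    using set_integral_halves[OF J integrable_abs[OF \<phi>]] by (simp only: distrib_left)
  moreover have "measure lebesgue J * U (avg J \<phi>) s \<le>
     measure lebesgue ?L * U (avg ?L \<phi>) ?s + measure lebesgue ?R * U (avg ?R \<phi>) ?s"
  proof -
    have eq: "m * ((u + v) / 2) = m / 2 * v + m / 2 * u" for m u v :: real
      by (simp add: field_simps)
    from mult_left_mono[OF mid[OF Suc.prems(2), of "avg J \<phi>" ?a], of "measure lebesgue J"]
    show ?thesis
      unfolding avg_half_eq[OF J \<phi>] measure_half[OF J] eq by simp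
  qed
  moreover have IH: "measure lebesgue I * U (avg I \<phi>) ?s \<le>
      C * (LINT x:I|lebesgue. \<bar>\<phi> x\<bar>) - measure lebesgue (?E I)" if "I \<in> dyadic_intervals" for I
    using Suc.IH[OF that, of ?s] Suc.prems(2) by simp
  ultimately show ?case
    using IH[OF half_dyadic(1)[OF J]] IH[OF half_dyadic(2)[OF J]] by linarith
qed

text \<open>A point of the level set may reach \<open>lam\<close> only in the limit, so no finite stage need exceed
  it; rescaling \<open>U\<close> by \<open>z < 1\<close> lowers the level to \<open>z\<^sup>2 * lam\<close>, which a finite stage does reach.\<close>

lemma bellman_level_fraction:
  fixes U :: "real \<Rightarrow> real \<Rightarrow> real"
  assumes mid: "\<And>x a s. s \<ge> 0 \<Longrightarrow> U x s \<le> (U (x + a) (s + a\<^sup>2) + U (x - a) (s + a\<^sup>2)) / 2"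
    and maj: "\<And>x s. s \<ge> 0 \<Longrightarrow> U x s \<le> C * \<bar>x\<bar> - (if s \<ge> lam then 1 else 0)"
    and "U 0 0 \<ge> 0" "C \<ge> 0" "lam > 0"
    and \<phi>: "integrable lebesgue \<phi>" and J: "J \<in> dyadic_intervals" and "avg J \<phi> = 0"
  shows "level_fraction J \<phi> lam \<le> C * avg J (\<lambda>x. \<bar>\<phi> x\<bar>)"
proof -
  let ?A = "LINT x:J|lebesgue. \<bar>\<phi> x\<bar>" and ?S = "{x \<in> J. square_fun_sq J \<phi> x \<ge> ennreal lam}"
  have "z * measure lebesgue ?S \<le> C * ?A" if z: "0 < z" "z < 1" for z
  proof -
    define E where "E = (\<lambda>n. {x \<in> J. z\<^sup>2 * lam \<le> finite_square_fun n J \<phi> x})"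
    have E: "E n \<in> sets lebesgue" for n
    proof -
      note [measurable] = finite_square_fun_measurable[OF J, of n \<phi>]
      have [measurable]: "J \<in> sets lebesgue" using dyadic_lmeasurable[OF J] by simp
      have "{x \<in> space lebesgue. x \<in> J \<and> z\<^sup>2 * lam \<le> finite_square_fun n J \<phi> x} \<in> sets lebesgue"
        by measurable
      then show ?thesis by (simp add: E_def)
    qed
    have fin: "(\<Union>n. E n) \<in> lmeasurable"
    proof (rule fmeasurableI2[OF dyadic_lmeasurable[OF J]])
      show "(\<Union>n. E n) \<subseteq> J" by (auto simp: E_def)
      show "(\<Union>n. E n) \<in> sets lebesgue" using E by blast
    qed
    \<comment> \<open>Passing to \<open>U (x / z) (s / z\<^sup>2)\<close> keeps the midpoint
      inequality, as a step \<open>a\<close> becomes \<open>a / z\<close>; the price is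
      \<open>C / z\<close> in place of \<open>C\<close>.\<close>
    have bound: "measure lebesgue (E n) \<le> C / z * ?A" for n
    proof -
      have "measure lebesgue J * U (avg J \<phi> / z) (0 / z\<^sup>2) \<le>
        C / z * ?A - measure lebesgue {x \<in> J. 0 + finite_square_fun n J \<phi> x \<ge> z\<^sup>2 * lam}"
      proof (rule bellman_finite_levels[where U = "\<lambda>x s. U (x / z) (s / z\<^sup>2)"])
        show "U (x / z) (s / z\<^sup>2) \<le> (U ((x + a) / z) ((s + a\<^sup>2) / z\<^sup>2) + U ((x - a) / z) ((s + a\<^sup>2) / z\<^sup>2)) / 2"
          if "s \<ge> 0" for x a s
          using mid[of "s / z\<^sup>2" "x / z" "a / z"] that
          by (simp only: add_divide_distrib diff_divide_distrib power_divide) simp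
        show "U (x / z) (s / z\<^sup>2) \<le> C / z * \<bar>x\<bar> - (if z\<^sup>2 * lam \<le> s then 1 else 0)"
          if "s \<ge> 0" for x s
        proof -
          have le: "(z\<^sup>2 * lam \<le> s) = (lam \<le> s / z\<^sup>2)"
            using z by (simp add: pos_le_divide_eq mult.commute)
          have eq: "C / z * \<bar>x\<bar> = C * \<bar>x / z\<bar>"
            using z by (simp add: abs_of_pos)
          have "0 \<le> s / z\<^sup>2" using that by simp
          from maj[OF this, of "x / z"] show ?thesis unfolding le eq .
        qed
        show "C / z \<ge> 0" using \<open>C \<ge> 0\<close> z by simp
      qed (use \<phi> J in simp_all)
      moreover have "measure lebesgue J * U (avg J \<phi> / z) (0 / z\<^sup>2) \<ge> 0"
        using \<open>U 0 0 \<ge> 0\<close> \<open>avg J \<phi> = 0\<close> by simp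
      moreover have "{x \<in> J. 0 + finite_square_fun n J \<phi> x \<ge> z\<^sup>2 * lam} = E n"
        by (simp add: E_def)
      ultimately show ?thesis by simp
    qed
    have "incseq E"
    proof (rule incseq_SucI)
      show "E n \<subseteq> E (Suc n)" for n
      proof
        fix x assume "x \<in> E n"
        moreover have "finite_square_fun n J \<phi> x \<le> finite_square_fun (Suc n) J \<phi> x"
          by (rule finite_square_fun_mono) simp
        ultimately show "x \<in> E (Suc n)" unfolding E_def mem_Collect_eq by linarith
      qed
    qed
    moreover have "range E \<subseteq> sets lebesgue" using E by blast
    ultimately have "(\<lambda>n. measure lebesgue (E n)) \<longlonglongrightarrow> measure lebesgue (\<Union>n. E n)"
      using fmeasurableD2[OF fin] by (intro Lim_measure_incseq) simp_all
    then have "measure lebesgue (\<Union>n. E n) \<le> C / z * ?A"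
      using bound by (intro LIMSEQ_le_const2) auto
    moreover have "?S \<subseteq> (\<Union>n. E n)"
    proof
      fix x assume x: "x \<in> ?S"
      show "x \<in> (\<Union>n. E n)"
      proof (rule ccontr)
        assume "x \<notin> (\<Union>n. E n)"
        then have notin: "x \<notin> E n" for n by blast
        have "finite_square_fun n J \<phi> x \<le> z\<^sup>2 * lam" for n
          using x notin[of n] by (simp add: E_def)
        moreover have "x \<in> J" and "ennreal lam \<le> square_fun_sq J \<phi> x" using x by blast+
        ultimately have "ennreal lam \<le> ennreal (z\<^sup>2 * lam)"
          using square_fun_sq_le[OF J] order_trans by blast
        then have "lam \<le> z\<^sup>2 * lam" using z \<open>lam > 0\<close> by (simp add: ennreal_le_iff)
        moreover have "z\<^sup>2 < 1" using z by (simp add: abs_square_less_1)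
        ultimately show False using \<open>lam > 0\<close> by simp
      qed
    qed
    \<comment> \<open>Measurability of \<open>?S\<close> is not established; a non-measurable set
      has \<open>measure\<close> 0 by default, so the bound holds in either case.\<close>
    then have "measure lebesgue ?S \<le> measure lebesgue (\<Union>n. E n)"
    proof (cases "?S \<in> sets lebesgue")
      case True
      with \<open>?S \<subseteq> (\<Union>n. E n)\<close> show ?thesis using fin by (rule measure_mono_fmeasurable)
    qed (simp add: measure_notin_sets)
    ultimately have "measure lebesgue ?S \<le> C / z * ?A" by linarith
    then show ?thesis using z by (simp add: field_simps)
  qed
  \<comment> \<open>The factor lost in the rescaling is recovered as \<open>z\<close> tends to
    1.\<close>
  then have "measure lebesgue ?S \<le> C * ?A" by (rule field_le_mult_one_interval)
  then show ?thesis
    using measure_dyadic_pos[OF J] by (simp add: level_fraction_def avg_def divide_right_mono)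
qed

section \<open>The weak-type bound\<close>

text \<open>Both branches of the maximum have the submartingale property. For \<open>1 \<le> \<bar>x\<bar> \<le> 2\<close> the linear branch
  dominates the quadratic one, and a step from \<open>\<bar>x\<bar> \<le> 1\<close> beyond \<open>2\<close> is long enough for the linear
  branch alone to suffice.\<close>

definition weak_type_bellman :: "real \<Rightarrow> real \<Rightarrow> real" where
  "weak_type_bellman x s =
     (if \<bar>x\<bar> \<le> 1 then max (2 * x\<^sup>2 - s) (5 * \<bar>x\<bar> - 1) else 5 * \<bar>x\<bar> - 1)"

lemma weak_type_bellman_ge: "5 * \<bar>x\<bar> - 1 \<le> weak_type_bellman x s"
  by (simp add: weak_type_bellman_def)

lemma weak_type_bellman_ge_quadratic:
  assumes "\<bar>x\<bar> \<le> 2" "s \<ge> 0"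
  shows "2 * x\<^sup>2 - s \<le> weak_type_bellman x s"
proof (cases "\<bar>x\<bar> \<le> 1")
  case True
  then show ?thesis by (simp add: weak_type_bellman_def)
next
  case False
  then have "(\<bar>x\<bar> - 1) * (\<bar>x\<bar> - 2) \<le> 0" using assms by (intro mult_nonneg_nonpos) auto
  \<comment> \<open>This gives \<open>2 * x\<^sup>2 \<le> 6 * \<bar>x\<bar> - 4\<close>, which is
    below \<open>5 * \<bar>x\<bar> - 1\<close> because \<open>\<bar>x\<bar> \<le> 2\<close>.\<close>
  then have "x\<^sup>2 - 3 * \<bar>x\<bar> + 2 \<le> 0" by (simp add: algebra_simps power2_eq_square)
  with False show ?thesis using assms by (simp add: weak_type_bellman_def)
qed

lemma weak_type_bellman_mid:
  assumes "s \<ge> 0"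
  shows "weak_type_bellman x s \<le>
    (weak_type_bellman (x + a) (s + a\<^sup>2) + weak_type_bellman (x - a) (s + a\<^sup>2)) / 2"
proof -
  define r where "r = weak_type_bellman (x + a) (s + a\<^sup>2) + weak_type_bellman (x - a) (s + a\<^sup>2)"
  have lin: "5 * \<bar>x + a\<bar> + 5 * \<bar>x - a\<bar> - 2 \<le> r"
    using weak_type_bellman_ge[of "x + a" "s + a\<^sup>2"] weak_type_bellman_ge[of "x - a" "s + a\<^sup>2"]
    by (simp add: r_def)
  moreover have "2 * \<bar>x\<bar> \<le> \<bar>x + a\<bar> + \<bar>x - a\<bar>"
    using abs_triangle_ineq[of "x + a" "x - a"] by simp
  ultimately have "5 * \<bar>x\<bar> - 1 \<le> r / 2" by simp
  moreover have "2 * x\<^sup>2 - s \<le> r / 2" if x: "\<bar>x\<bar> \<le> 1"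
  proof (cases "\<bar>x + a\<bar> \<le> 2 \<and> \<bar>x - a\<bar> \<le> 2")
    case True
    then have "2 * (x + a)\<^sup>2 - (s + a\<^sup>2) \<le> weak_type_bellman (x + a) (s + a\<^sup>2)"
      "2 * (x - a)\<^sup>2 - (s + a\<^sup>2) \<le> weak_type_bellman (x - a) (s + a\<^sup>2)"
      using assms by (auto intro!: weak_type_bellman_ge_quadratic)
    \<comment> \<open>On average \<open>2 * x\<^sup>2\<close> gains \<open>2 * a\<^sup>2\<close>,
      which pays for the growth of \<open>s\<close> by \<open>a\<^sup>2\<close>.\<close>
    moreover have "2 * (x + a)\<^sup>2 + 2 * (x - a)\<^sup>2 = 4 * x\<^sup>2 + 4 * a\<^sup>2" "a\<^sup>2 \<ge> 0"
      by (simp_all add: power2_eq_square algebra_simps)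
    ultimately have "4 * x\<^sup>2 - 2 * s \<le> r" unfolding r_def by linarith
    then show ?thesis by simp
  next
    case False
    then have "2 \<le> \<bar>x + a\<bar> + \<bar>x - a\<bar>" using x by linarith
    moreover have "x\<^sup>2 \<le> 1" using x by (simp add: abs_square_le_1)
    ultimately show ?thesis using lin assms by simp
  qed
  ultimately show ?thesis unfolding weak_type_bellman_def[of x s] r_def[symmetric] by (auto simp: max_def)
qed

lemma weak_type_bellman_le:
  assumes "s \<ge> 0"
  shows "weak_type_bellman x s \<le> 5 * \<bar>x\<bar> - (if s \<ge> 1 then 1 else 0)"
proof -
  have "x\<^sup>2 \<le> \<bar>x\<bar>" if "\<bar>x\<bar> \<le> 1"
    using mult_right_mono[OF that, of "\<bar>x\<bar>"] by (simp add: power2_eq_square)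
  then show ?thesis using assms by (auto simp: weak_type_bellman_def)
qed

text \<open>Scaling \<open>x\<close> by \<open>1 / sqrt lam\<close> and \<open>s\<close> by
  \<open>1 / lam\<close> normalizes the level to 1.\<close>

lemma square_fun_weak_type:
  assumes "lam > 0" "integrable lebesgue \<phi>" "J \<in> dyadic_intervals" "avg J \<phi> = 0"
  shows "level_fraction J \<phi> lam \<le> 5 / sqrt lam * avg J (\<lambda>x. \<bar>\<phi> x\<bar>)"
proof (rule bellman_level_fraction[where U = "\<lambda>x s. weak_type_bellman (x / sqrt lam) (s / lam)"])
  show "weak_type_bellman (x / sqrt lam) (s / lam) \<le>
      (weak_type_bellman ((x + a) / sqrt lam) ((s + a\<^sup>2) / lam) +
       weak_type_bellman ((x - a) / sqrt lam) ((s + a\<^sup>2) / lam)) / 2" if "s \<ge> 0" for x a s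
  proof -
    have "(a / sqrt lam)\<^sup>2 = a\<^sup>2 / lam" using assms(1) by (simp add: power_divide)
    then show ?thesis
      using weak_type_bellman_mid[of "s / lam" "x / sqrt lam" "a / sqrt lam"] that assms(1)
      by (simp only: add_divide_distrib diff_divide_distrib zero_le_divide_iff) auto
  qed
  show "weak_type_bellman (x / sqrt lam) (s / lam) \<le>
      5 / sqrt lam * \<bar>x\<bar> - (if lam \<le> s then 1 else 0)" if "s \<ge> 0" for x s
    using weak_type_bellman_le[of "s / lam" "x / sqrt lam"] that assms(1)
    by (simp add: le_divide_eq abs_divide)
  show "weak_type_bellman (0 / sqrt lam) (0 / lam) \<ge> 0" by (simp add: weak_type_bellman_def)
qed (use assms in simp_all)

section \<open>The Bellman function of finite martingales\<close>

text \<open>\<open>tree_value mu f v\<close>: some finite dyadic martingale starting at \<open>f\<close> has square function at least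
  \<open>mu\<close> everywhere, and its terminal value has mean absolute value \<open>v\<close>.\<close>

inductive tree_value :: "real \<Rightarrow> real \<Rightarrow> real \<Rightarrow> bool" where
  leaf: "mu \<le> 0 \<Longrightarrow> tree_value mu f \<bar>f\<bar>"
| node: "tree_value (mu - a\<^sup>2) (f + a) v \<Longrightarrow> tree_value (mu - a\<^sup>2) (f - a) w
    \<Longrightarrow> tree_value mu f ((v + w) / 2)"

lemma tree_value_ge: "tree_value mu f v \<Longrightarrow> \<bar>f\<bar> \<le> v"
  by (induction rule: tree_value.induct) auto

lemma tree_value_antimono: "tree_value mu f v \<Longrightarrow> nu \<le> mu \<Longrightarrow> tree_value nu f v"
proof (induction arbitrary: nu rule: tree_value.induct)
  case (leaf mu f)
  then show ?case by (intro tree_value.leaf) simp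
next
  case (node mu a f v w)
  then show ?case by (intro tree_value.node[where a = a]) auto
qed

text \<open>Each step of size 1 uses up 1 of the required \<open>mu\<close>, so finitely many
  suffice.\<close>

lemma tree_value_exists: "\<exists>v. tree_value mu f v"
proof -
  have "\<exists>v. tree_value mu f v" if "mu \<le> real n" for n
    using that
  proof (induction n arbitrary: mu f)
    case 0
    then show ?case using tree_value.leaf by auto
  next
    case (Suc n)
    then have "mu - 1\<^sup>2 \<le> real n" by simp
    then obtain v w where "tree_value (mu - 1\<^sup>2) (f + 1) v" "tree_value (mu - 1\<^sup>2) (f - 1) w"
      using Suc.IH by metis
    then show ?case using tree_value.node by blast
  qed
  then show ?thesis using real_arch_simple by blast
qed

text \<open>From \<open>f \<noteq> 0\<close> the martingale moves to \<open>0\<close> or \<open>2 * f\<close>. While it does not vanish it keeps its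
  sign, so the mean of its absolute value stays \<open>\<bar>f\<bar>\<close>; once it vanishes, the given tree
  with root \<open>0\<close> is started.\<close>

lemma tree_value_via_zero:
  assumes v0: "tree_value lam 0 v0" and "mu \<le> lam"
  obtains v where "tree_value mu f v" "v \<le> \<bar>f\<bar> + v0"
proof -
  have "v0 \<ge> 0" using tree_value_ge[OF v0] by simp
  \<comment> \<open>Here \<open>k\<close> bounds the number of doublings still to be made: each step
    from \<open>f\<close> uses up \<open>f\<^sup>2\<close> and the later ones are longer.\<close>
  have *: "\<exists>v. tree_value mu f v \<and> v \<le> \<bar>f\<bar> + v0" if "mu \<le> lam" "mu \<le> real k * f\<^sup>2" for k mu f
    using that
  proof (induction k arbitrary: mu f)
    case 0
    then show ?case using tree_value.leaf[of mu f] \<open>v0 \<ge> 0\<close> by (intro exI[of _ "\<bar>f\<bar>"]) simp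
  next
    case (Suc k)
    have sq: "f\<^sup>2 \<ge> 0" by simp
    have "mu - f\<^sup>2 \<le> real k * f\<^sup>2" using Suc.prems(2) by (simp add: algebra_simps)
    also have "\<dots> \<le> real k * (f + f)\<^sup>2"
      by (intro mult_left_mono) (auto simp: power2_eq_square algebra_simps)
    finally obtain v where v: "tree_value (mu - f\<^sup>2) (f + f) v" "v \<le> \<bar>f + f\<bar> + v0"
      using Suc.IH[of "mu - f\<^sup>2" "f + f"] Suc.prems(1) sq by (auto simp: algebra_simps)
    have "tree_value (mu - f\<^sup>2) (f - f) v0"
      using tree_value_antimono[OF v0, of "mu - f\<^sup>2"] Suc.prems(1) sq by (simp add: algebra_simps)
    with v(1) have "tree_value mu f ((v + v0) / 2)" by (rule tree_value.node)
    moreover have "(v + v0) / 2 \<le> \<bar>f\<bar> + v0" using v(2) \<open>v0 \<ge> 0\<close> by simp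
    ultimately show ?case by blast
  qed
  show ?thesis
  proof (cases "f = 0")
    case True
    then show ?thesis using that tree_value_antimono[OF assms] by simp
  next
    case False
    obtain k where "mu / f\<^sup>2 \<le> real k" using real_arch_simple by blast
    then have "mu \<le> real k * f\<^sup>2" using False by (simp add: field_simps)
    then show ?thesis using * that \<open>mu \<le> lam\<close> by blast
  qed
qed

text \<open>The function B of the overview, with its arguments exchanged. The infimum is genuine:
  trees exist for all arguments, and their values are at least \<open>\<bar>f\<bar>\<close>.\<close>

definition tree_bellman :: "real \<Rightarrow> real \<Rightarrow> real" where
  "tree_bellman mu f = Inf {v. tree_value mu f v}"

lemma tree_bellman_le: "tree_value mu f v \<Longrightarrow> tree_bellman mu f \<le> v"
  unfolding tree_bellman_def
  by (intro cInf_lower) (auto intro!: bdd_belowI2[where f = id] dest: tree_value_ge)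

lemma le_tree_bellman: "(\<And>v. tree_value mu f v \<Longrightarrow> c \<le> v) \<Longrightarrow> c \<le> tree_bellman mu f"
  unfolding tree_bellman_def using tree_value_exists by (intro cInf_greatest) auto

text \<open>Trees at \<open>f + a\<close> and \<open>f - a\<close> joined under one root compete for
  the infimum at \<open>f\<close>; the infima over the two subtrees are taken one after the
  other.\<close>

lemma tree_bellman_mid:
  "tree_bellman mu f \<le> (tree_bellman (mu - a\<^sup>2) (f + a) + tree_bellman (mu - a\<^sup>2) (f - a)) / 2"
proof -
  have "2 * tree_bellman mu f - w \<le> tree_bellman (mu - a\<^sup>2) (f + a)"
    if w: "tree_value (mu - a\<^sup>2) (f - a) w" for w
  proof (rule le_tree_bellman)
    fix v assume "tree_value (mu - a\<^sup>2) (f + a) v"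
    from tree_bellman_le[OF tree_value.node[OF this w]]
    show "2 * tree_bellman mu f - w \<le> v" by simp
  qed
  then have "2 * tree_bellman mu f - tree_bellman (mu - a\<^sup>2) (f + a) \<le> w"
    if "tree_value (mu - a\<^sup>2) (f - a) w" for w
    using that by (simp add: algebra_simps)
  then have "2 * tree_bellman mu f - tree_bellman (mu - a\<^sup>2) (f + a) \<le> tree_bellman (mu - a\<^sup>2) (f - a)"
    by (rule le_tree_bellman)
  then show ?thesis by simp
qed

lemma tree_bellman_le_zero:
  assumes "mu \<le> lam"
  shows "tree_bellman mu f \<le> \<bar>f\<bar> + tree_bellman lam 0"
proof -
  have "tree_bellman mu f - \<bar>f\<bar> \<le> v0" if v0: "tree_value lam 0 v0" for v0
  proof -
    obtain v where "tree_value mu f v" "v \<le> \<bar>f\<bar> + v0" by (rule tree_value_via_zero[OF v0 assms])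
    then show ?thesis using tree_bellman_le[of mu f v] by simp
  qed
  then have "tree_bellman mu f - \<bar>f\<bar> \<le> tree_bellman lam 0" by (rule le_tree_bellman)
  then show ?thesis by simp
qed

text \<open>The function U of the overview is divided by its drop \<open>K\<close>, which makes the
  drop equal to 1 as the Bellman induction requires.\<close>

lemma level_fraction_le_tree_bellman:
  assumes "lam > 0" "tree_bellman lam 0 > 0"
    and "integrable lebesgue \<phi>" "J \<in> dyadic_intervals" "avg J \<phi> = 0"
  shows "level_fraction J \<phi> lam \<le> avg J (\<lambda>x. \<bar>\<phi> x\<bar>) / tree_bellman lam 0"
proof -
  define K where "K = tree_bellman lam 0"
  have K: "K > 0" using assms by (simp add: K_def)
  have "level_fraction J \<phi> lam \<le> 1 / K * avg J (\<lambda>x. \<bar>\<phi> x\<bar>)"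
  proof (rule bellman_level_fraction[where U = "\<lambda>x s. (tree_bellman (lam - s) x - K) / K"])
    show "(tree_bellman (lam - s) x - K) / K \<le>
        ((tree_bellman (lam - (s + a\<^sup>2)) (x + a) - K) / K +
         (tree_bellman (lam - (s + a\<^sup>2)) (x - a) - K) / K) / 2" for x a s
    proof -
      have eq: "(u / K + v / K) / 2 = ((u + v) / 2) / K" for u v
        by (simp add: add_divide_distrib)
      have "tree_bellman (lam - s) x - K \<le> ((tree_bellman (lam - (s + a\<^sup>2)) (x + a) - K) +
          (tree_bellman (lam - (s + a\<^sup>2)) (x - a) - K)) / 2"
        using tree_bellman_mid[of "lam - s" x a] by (simp add: diff_diff_eq field_simps)
      from divide_right_mono[OF this less_imp_le[OF K]] show ?thesis
        unfolding eq .
    qed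
    show "(tree_bellman (lam - s) x - K) / K \<le> 1 / K * \<bar>x\<bar> - (if lam \<le> s then 1 else 0)"
      if "s \<ge> 0" for x s
    proof -
      \<comment> \<open>Once \<open>lam \<le> s\<close>, a leaf is admissible and has value
        \<open>\<bar>x\<bar>\<close>; before that, the detour through 0 costs at most
        \<open>K\<close> more.\<close>
      have "tree_bellman (lam - s) x - K \<le> \<bar>x\<bar> - (if lam \<le> s then K else 0)"
        using tree_bellman_le_zero[of "lam - s" lam x]
          tree_bellman_le[OF tree_value.leaf[of "lam - s" x]] that
        by (auto simp: K_def)
      from divide_right_mono[OF this less_imp_le[OF K]] show ?thesis
        using K by (simp add: diff_divide_distrib split: if_splits)
    qed
  qed (use assms K in \<open>auto simp: K_def\<close>)
  then show ?thesis by (simp add: K_def)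
qed

section \<open>Realization of finite martingales by step functions\<close>

text \<open>A leaf becomes a constant on \<open>J\<close>. At a node the subtree of
  \<open>f + a\<close> is placed on the right half and that of \<open>f - a\<close> on the left, so
  that \<open>half_diff\<close> equals \<open>a\<close>.\<close>

lemma tree_value_realize:
  assumes "tree_value mu f v" "J \<in> dyadic_intervals"
  shows "\<exists>\<phi>. integrable_supported J \<phi> \<and> avg J \<phi> = f \<and> avg J (\<lambda>x. \<bar>\<phi> x\<bar>) = v \<and>
    (\<forall>x\<in>J. ennreal mu \<le> square_fun_sq J \<phi> x)"
  using assms
proof (induction arbitrary: J rule: tree_value.induct)
  case (leaf mu f)
  have const: "avg J (\<lambda>x. c * indicator J x) = c" for c
  proof -
    have "avg J (\<lambda>x. c * indicator J x) = avg J (\<lambda>x. c)"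
      by (rule avg_cong[OF leaf(2)]) simp
    also have "\<dots> = c"
      using measure_dyadic_pos[OF leaf(2)] dyadic_lmeasurable[OF leaf(2)]
      by (simp add: avg_def set_lebesgue_integral_def fmeasurable_def)
    finally show ?thesis .
  qed
  have "(\<lambda>x. \<bar>f * indicator J x\<bar>) = (\<lambda>x. \<bar>f\<bar> * indicator J x)" by (auto simp: indicator_def)
  then have "avg J (\<lambda>x. \<bar>f * indicator J x\<bar>) = \<bar>f\<bar>" using const by simp
  moreover have "integrable_supported J (\<lambda>x. f * indicator J x)"
    using dyadic_lmeasurable[OF leaf(2)] by (auto simp: integrable_supported_def fmeasurable_def)
  moreover have "ennreal mu = 0" using leaf(1) by (simp add: ennreal_neg)
  ultimately show ?case using const by (intro exI[of _ "\<lambda>x. f * indicator J x"]) auto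
next
  case (node mu a f v w)
  note J = node.prems
  let ?L = "left_half J" and ?R = "right_half J"
  obtain \<psi> where \<psi>: "integrable_supported ?R \<psi>" "avg ?R \<psi> = f + a"
    "avg ?R (\<lambda>x. \<bar>\<psi> x\<bar>) = v" "\<forall>x\<in>?R. ennreal (mu - a\<^sup>2) \<le> square_fun_sq ?R \<psi> x"
    using node.IH(1)[OF half_dyadic(2)[OF J]] by blast
  obtain \<eta> where \<eta>: "integrable_supported ?L \<eta>" "avg ?L \<eta> = f - a"
    "avg ?L (\<lambda>x. \<bar>\<eta> x\<bar>) = w" "\<forall>x\<in>?L. ennreal (mu - a\<^sup>2) \<le> square_fun_sq ?L \<eta> x"
    using node.IH(2)[OF half_dyadic(1)[OF J]] by blast
  define \<phi> where "\<phi> = (\<lambda>x. \<eta> x + \<psi> x)"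
  have L: "\<phi> x = \<eta> x" if "x \<in> ?L" for x
    using that \<psi>(1) half_partition[OF J] by (auto simp: \<phi>_def integrable_supported_def)
  have R: "\<phi> x = \<psi> x" if "x \<in> ?R" for x
    using that \<eta>(1) half_partition[OF J] by (auto simp: \<phi>_def integrable_supported_def)
  have int: "integrable lebesgue \<phi>"
    using \<psi>(1) \<eta>(1) by (simp add: \<phi>_def integrable_supported_def)
  have avgs: "avg ?L \<phi> = f - a" "avg ?R \<phi> = f + a"
    "avg ?L (\<lambda>x. \<bar>\<phi> x\<bar>) = w" "avg ?R (\<lambda>x. \<bar>\<phi> x\<bar>) = v"
    using avg_cong[OF half_dyadic(1)[OF J], of \<phi> \<eta>] avg_cong[OF half_dyadic(2)[OF J], of \<phi> \<psi>]
      avg_cong[OF half_dyadic(1)[OF J], of "\<lambda>x. \<bar>\<phi> x\<bar>" "\<lambda>x. \<bar>\<eta> x\<bar>"]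
      avg_cong[OF half_dyadic(2)[OF J], of "\<lambda>x. \<bar>\<phi> x\<bar>" "\<lambda>x. \<bar>\<psi> x\<bar>"] L R \<psi> \<eta> by simp_all
  have "\<phi> x = 0" if "x \<notin> J" for x
  proof -
    have "x \<notin> ?L" "x \<notin> ?R" using that half_partition(1)[OF J] by blast+
    then show ?thesis using \<psi>(1) \<eta>(1) by (simp add: integrable_supported_def \<phi>_def)
  qed
  with int have "integrable_supported J \<phi>" by (simp add: integrable_supported_def)
  moreover have "avg J \<phi> = f" "avg J (\<lambda>x. \<bar>\<phi> x\<bar>) = (v + w) / 2"
    using avg_halves[OF J int] avg_halves[OF J integrable_abs[OF int]] avgs by simp_all
  moreover have "ennreal mu \<le> square_fun_sq J \<phi> x" if "x \<in> J" for x
  proof -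
    obtain H where H: "H = ?L \<or> H = ?R" "x \<in> H" using \<open>x \<in> J\<close> half_partition[OF J] by blast
    have a: "half_diff J \<phi> = a" by (simp add: half_diff_def avgs)
    have "ennreal (mu - a\<^sup>2) \<le> square_fun_sq H \<phi> x"
      using H \<psi>(4) \<eta>(4) square_fun_sq_cong[OF half_dyadic(1)[OF J] L]
        square_fun_sq_cong[OF half_dyadic(2)[OF J] R] by auto
    then have "ennreal (a\<^sup>2) + ennreal (mu - a\<^sup>2) \<le> square_fun_sq J \<phi> x"
      using square_fun_sq_ge[OF J that H(1), of \<phi>] unfolding a by (meson add_left_mono order_trans)
    \<comment> \<open>Since \<open>ennreal\<close> sends negative numbers to 0, additivity applies
      only for \<open>a\<^sup>2 \<le> mu\<close>; otherwise \<open>a\<^sup>2\<close> alone exceeds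
      \<open>mu\<close>.\<close>
    moreover have "ennreal mu \<le> ennreal (a\<^sup>2) + ennreal (mu - a\<^sup>2)"
    proof (cases "a\<^sup>2 \<le> mu")
      case True
      then show ?thesis using ennreal_plus[of "a\<^sup>2" "mu - a\<^sup>2"] by simp
    next
      case False
      then show ?thesis by (intro add_increasing2 ennreal_leI) auto
    qed
    ultimately show ?thesis by (rule order_trans[rotated])
  qed
  ultimately show ?case by blast
qed

section \<open>Comparison of the extremal quantities\<close>

lemma unit_interval_dyadic: "{0..<1} \<in> dyadic_intervals"
  unfolding dyadic_intervals_def by (auto intro!: exI[of _ 0])

text \<open>Positivity comes from the weak-type bound at level fraction 1, which forces a mean of at
  least \<open>sqrt lam / 5\<close>. Trees realized on the unit interval are competitors in the
  infimum; they give the upper bound and show that the infimum is over a nonempty set.\<close>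

lemma L_bell_bounds:
  assumes "lam > 0"
  shows "L_bell 0 1 lam > 0" "L_bell 0 1 lam \<le> tree_bellman lam 0"
proof -
  define X where "X = {avg J (\<lambda>x. \<bar>\<phi> x\<bar>) | J \<phi>. J \<in> dyadic_intervals \<and> integrable_supported J \<phi> \<and>
            avg J \<phi> = 0 \<and> level_fraction J \<phi> lam = 1}"
  have L: "L_bell 0 1 lam = Inf X" by (simp add: L_bell_def X_def)
  have lower: "sqrt lam / 5 \<le> y" if "y \<in> X" for y
  proof -
    obtain J \<phi> where y: "y = avg J (\<lambda>x. \<bar>\<phi> x\<bar>)" and *: "J \<in> dyadic_intervals"
      "integrable_supported J \<phi>" "avg J \<phi> = 0" "level_fraction J \<phi> lam = 1"
      using \<open>y \<in> X\<close> by (auto simp: X_def)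
    have "1 \<le> 5 / sqrt lam * y"
      using square_fun_weak_type[of lam \<phi> J] * assms by (simp add: integrable_supported_def y)
    then show ?thesis using assms by (simp add: field_simps)
  qed
  have trees: "v \<in> X" if v: "tree_value lam 0 v" for v
  proof -
    let ?J = "{0..<1::real}"
    obtain \<phi> where \<phi>: "integrable_supported ?J \<phi>" "avg ?J \<phi> = 0" "avg ?J (\<lambda>x. \<bar>\<phi> x\<bar>) = v"
      "\<forall>x\<in>?J. ennreal lam \<le> square_fun_sq ?J \<phi> x"
      using tree_value_realize[OF v unit_interval_dyadic] by blast
    have "{x \<in> ?J. ennreal lam \<le> square_fun_sq ?J \<phi> x} = ?J" using \<phi>(4) by blast
    then have "level_fraction ?J \<phi> lam = 1"
      unfolding level_fraction_def by simp
    then show ?thesis using \<phi> unit_interval_dyadic by (auto simp: X_def)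
  qed
  have "X \<noteq> {}" using trees tree_value_exists by blast
  then have "sqrt lam / 5 \<le> Inf X" using lower by (intro cInf_greatest)
  then show "L_bell 0 1 lam > 0" using assms L by (smt (verit) divide_pos_pos real_sqrt_gt_zero)
  have "bdd_below X" using lower by (rule bdd_belowI)
  then show "L_bell 0 1 lam \<le> tree_bellman lam 0"
    unfolding L by (intro le_tree_bellman cInf_lower trees)
qed

theorem theorem4p1:
  fixes F lam :: real
  assumes "F \<ge> 0" and "lam > 0"
  shows "M_bell 0 F lam \<le> F / L_bell 0 1 lam \<and> F / L_bell 0 1 lam = F / Lb_bell 0 lam"
proof -
  note L = L_bell_bounds[OF assms(2)]
  define Y where "Y = {level_fraction J \<phi> lam | J \<phi>. J \<in> dyadic_intervals \<and> integrable_supported J \<phi> \<and>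
            avg J \<phi> = 0 \<and> avg J (\<lambda>x. \<bar>\<phi> x\<bar>) = F}"
  \<comment> \<open>A supremum over the empty set would be unspecified. One step from 0 to
    \<plusminus>F supplies an admissible function with the prescribed means.\<close>
  have "tree_value 0 0 F"
  proof -
    have "tree_value (F\<^sup>2 - F\<^sup>2) (0 + F) \<bar>0 + F\<bar>" "tree_value (F\<^sup>2 - F\<^sup>2) (0 - F) \<bar>0 - F\<bar>"
      by (intro tree_value.leaf; simp)+
    from tree_value.node[OF this] have "tree_value (F\<^sup>2) 0 F" using assms(1) by simp
    then show ?thesis by (rule tree_value_antimono) simp
  qed
  from tree_value_realize[OF this unit_interval_dyadic] have "Y \<noteq> {}"
    using unit_interval_dyadic by (auto simp: Y_def)
  moreover have "y \<le> F / L_bell 0 1 lam" if "y \<in> Y" for y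
  proof -
    obtain J \<phi> where y: "y = level_fraction J \<phi> lam" and *: "J \<in> dyadic_intervals"
      "integrable_supported J \<phi>" "avg J \<phi> = 0" "avg J (\<lambda>x. \<bar>\<phi> x\<bar>) = F"
      using \<open>y \<in> Y\<close> by (auto simp: Y_def)
    have "y \<le> F / tree_bellman lam 0"
      using level_fraction_le_tree_bellman[of lam \<phi> J] * assms L
      by (simp add: integrable_supported_def y)
    \<comment> \<open>Shrinking the denominator from \<open>tree_bellman lam 0\<close> to
      \<open>L_bell 0 1 lam\<close> enlarges the quotient because the latter is still
      positive.\<close>
    also have "\<dots> \<le> F / L_bell 0 1 lam"
      using L assms(1) by (intro divide_left_mono) auto
    finally show ?thesis .
  qed
  ultimately have "Sup Y \<le> F / L_bell 0 1 lam" by (rule cSup_least)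
  then show ?thesis by (simp add: M_bell_def Y_def Lb_bell_def)
qed

end
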